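(* Let $r\in\mathbb N$ and $k\ge2$ be an integer. Then $$\operatorname{Tv}_{\ell_\infty^{2^{rk}}}(r,k)\ge\frac12.$$
   Context: $\ell_\infty^N$ is $\mathbb R^N$ with the maximum norm. For a Banach space $X$ and pairwise disjoint $Z_1,\dots,Z_r\subset X$, each of cardinality $k\ge2$, put $S=\bigcup_{j=1}^rZ_j$ and $D=\max_j\operatorname{diam}Z_j$. A colorful $k$-partition is a partition $S=S_1\sqcup\dots\sqcup S_k$ with $|S_i\cap Z_j|=1$ for all $1\le i\le k$, $1\le j\le r$. Then $\operatorname{Tv}_X(r,k)=\sup_{Z_1,\dots,Z_r}\inf\frac{\max_{1\le i\le k}\operatorname{dist}(x,\operatorname{conv}S_i)}{D}$, the infimum over all points $x\in X$ and all colorful $k$-partitions. *)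

theory Defs
  imports "HOL-Analysis.Analysis"
begin

section \<open>The space \<open>\<ell>\<^sub>\<infinity>\<^sup>N\<close>\<close>

text \<open>\<open>\<ell>\<^sub>\<infinity>\<^sup>N\<close> is \<open>'n linf\<close> for a finite index type with \<open>CARD('n) = N\<close>. A type of its own is
  needed because \<open>real ^ 'n\<close> carries the Euclidean norm.\<close>

typedef 'n linf = "UNIV :: ('n \<Rightarrow> real) set"
  morphisms coord Abs_linf
  by simp

lemma linf_eqI: "(\<And>i. coord x i = coord y i) \<Longrightarrow> x = y"
  by (metis coord_inject ext)

lemma coord_Abs_linf [simp]: "coord (Abs_linf f) = f"
  by (simp add: Abs_linf_inverse)

instantiation linf :: (finite) real_normed_vector
begin

definition zero_linf :: "'a linf" where "0 = Abs_linf (\<lambda>i. 0)"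
definition plus_linf :: "'a linf \<Rightarrow> 'a linf \<Rightarrow> 'a linf"
  where "x + y = Abs_linf (\<lambda>i. coord x i + coord y i)"
definition minus_linf :: "'a linf \<Rightarrow> 'a linf \<Rightarrow> 'a linf"
  where "x - y = Abs_linf (\<lambda>i. coord x i - coord y i)"
definition uminus_linf :: "'a linf \<Rightarrow> 'a linf"
  where "- x = Abs_linf (\<lambda>i. - coord x i)"
definition scaleR_linf :: "real \<Rightarrow> 'a linf \<Rightarrow> 'a linf"
  where "c *\<^sub>R x = Abs_linf (\<lambda>i. c * coord x i)"
definition norm_linf :: "'a linf \<Rightarrow> real"
  where "norm x = (MAX i. \<bar>coord x i\<bar>)"
definition dist_linf :: "'a linf \<Rightarrow> 'a linf \<Rightarrow> real"
  where "dist (x :: 'a linf) y = norm (x - y)"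
definition sgn_linf :: "'a linf \<Rightarrow> 'a linf"
  where "sgn (x :: 'a linf) = inverse (norm x) *\<^sub>R x"
definition uniformity_linf :: "('a linf \<times> 'a linf) filter"
  where "uniformity = (INF e\<in>{0<..}. principal {(x, y :: 'a linf). dist x y < e})"
definition open_linf :: "'a linf set \<Rightarrow> bool"
  where "open (U :: 'a linf set) \<longleftrightarrow> (\<forall>x\<in>U. \<forall>\<^sub>F (x', y) in uniformity. x' = x \<longrightarrow> y \<in> U)"

lemma linf_norm_leI: "norm x \<le> b" if "\<And>i. \<bar>coord x i\<bar> \<le> b" for x :: "'a linf"
  using that by (simp add: norm_linf_def)

lemma abs_coord_le_linf_norm: "\<bar>coord x i\<bar> \<le> norm x" for x :: "'a linf"
  by (simp add: norm_linf_def)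

lemma coord_simps [simp]:
  "coord (0 :: 'a linf) i = 0"
  "coord (x + y) i = coord x i + coord y i"
  "coord (x - y) i = coord x i - coord y i"
  "coord (- x) i = - coord x i"
  "coord (c *\<^sub>R x) i = c * coord x i"
  by (simp_all add: zero_linf_def plus_linf_def minus_linf_def uminus_linf_def scaleR_linf_def)

instance
proof
  fix x y :: "'a linf" and c :: real
  show "norm x = 0 \<longleftrightarrow> x = 0"
  proof
    assume "norm x = 0"
    then have "coord x i = 0" for i
      using abs_coord_le_linf_norm[of x i] by simp
    then show "x = 0" by (intro linf_eqI) simp
  qed (simp add: norm_linf_def)
  show "norm (x + y) \<le> norm x + norm y"
    by (rule linf_norm_leI)
      (smt (verit) coord_simps(2) abs_coord_le_linf_norm)
  show "norm (c *\<^sub>R x) = \<bar>c\<bar> * norm x"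
  proof (rule antisym)
    show "norm (c *\<^sub>R x) \<le> \<bar>c\<bar> * norm x"
      by (rule linf_norm_leI)
        (simp add: abs_mult abs_coord_le_linf_norm mult_left_mono)
    have "norm x \<in> range (\<lambda>i. \<bar>coord x i\<bar>)"
      unfolding norm_linf_def by (rule Max_in) auto
    then obtain i where "norm x = \<bar>coord x i\<bar>" by auto
    then show "\<bar>c\<bar> * norm x \<le> norm (c *\<^sub>R x)"
      using abs_coord_le_linf_norm[of "c *\<^sub>R x" i] by (simp add: abs_mult)
  qed
qed (auto intro!: linf_eqI simp: algebra_simps sgn_linf_def dist_linf_def
      uniformity_linf_def open_linf_def)

end

instance linf :: (finite) banach
proof
  fix X :: "nat \<Rightarrow> 'a linf"
  assume X: "Cauchy X"
  have "\<exists>l. (\<lambda>n. coord (X n) i) \<longlonglongrightarrow> l" for i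
  proof -
    have "Cauchy (\<lambda>n. coord (X n) i)"
    proof (rule metric_CauchyI)
      fix e :: real assume "0 < e"
      then obtain M where M: "dist (X m) (X n) < e" if "m \<ge> M" "n \<ge> M" for m n
        using X unfolding Cauchy_def by blast
      have "dist (coord (X m) i) (coord (X n) i) < e" if "m \<ge> M" "n \<ge> M" for m n
        using M[OF that] abs_coord_le_linf_norm[of "X m - X n" i]
        by (simp add: dist_norm dist_linf_def)
      then show "\<exists>M. \<forall>m\<ge>M. \<forall>n\<ge>M. dist (coord (X m) i) (coord (X n) i) < e" by blast
    qed
    then show ?thesis using Cauchy_convergent convergent_def by blast
  qed
  then obtain l where l: "\<And>i. (\<lambda>n. coord (X n) i) \<longlonglongrightarrow> l i" by metis
  have "X \<longlonglongrightarrow> Abs_linf l"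
  proof (rule tendstoI)
    fix e :: real assume e: "0 < e"
    have "\<forall>\<^sub>F n in sequentially. \<forall>i. dist (coord (X n) i) (l i) < e / 2"
      using l e by (intro eventually_all_finite tendstoD) auto
    then show "\<forall>\<^sub>F n in sequentially. dist (X n) (Abs_linf l) < e"
    proof eventually_elim
      case (elim n)
      then have "norm (X n - Abs_linf l) \<le> e / 2"
        by (intro linf_norm_leI) (simp add: dist_real_def less_imp_le)
      with e show ?case by (simp add: dist_norm)
    qed
  qed
  then show "convergent X" by (rule convergentI)
qed


section \<open>The colorful Tverberg constant\<close>

definition color_classes :: "nat \<Rightarrow> nat \<Rightarrow> (nat \<Rightarrow> 'a set) \<Rightarrow> bool" where
  "color_classes r k Z \<longleftrightarrow>
     disjoint_family_on Z {1..r} \<and> (\<forall>j\<in>{1..r}. finite (Z j) \<and> card (Z j) = k)"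

definition colorful_partition :: "nat \<Rightarrow> nat \<Rightarrow> (nat \<Rightarrow> 'a set) \<Rightarrow> (nat \<Rightarrow> 'a set) \<Rightarrow> bool" where
  "colorful_partition r k Z S \<longleftrightarrow>
     disjoint_family_on S {1..k} \<and>
     (\<Union>i\<in>{1..k}. S i) = (\<Union>j\<in>{1..r}. Z j) \<and>
     (\<forall>i\<in>{1..k}. \<forall>j\<in>{1..r}. card (S i \<inter> Z j) = 1)"

text \<open>Supremum and infimum are taken in \<open>ereal\<close>, so that they are the order-theoretic ones also
  over empty or unbounded sets. The definition is meaningful for \<open>r \<ge> 1\<close> and \<open>k \<ge> 2\<close>, in which
  case the maxima range over nonempty sets, the denominator is positive and every \<open>S i\<close> is
  nonempty.\<close>

definition Tv :: "'a::banach itself \<Rightarrow> nat \<Rightarrow> nat \<Rightarrow> ereal" where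
  "Tv X r k =
     (SUP Z \<in> {Z :: nat \<Rightarrow> 'a set. color_classes r k Z}.
        INF (x, S) \<in> UNIV \<times> {S. colorful_partition r k Z S}.
          ereal ((MAX i\<in>{1..k}. infdist x (convex hull S i)) / (MAX j\<in>{1..r}. diameter (Z j))))"

end

theory Submission
  imports Defs
begin

text \<open>
  Index the coordinates by the subsets of the \<open>r k\<close>-element set of points, and let the point \<open>q\<close>
  have coordinate \<open>1\<close> at \<open>A\<close> if \<open>q \<in> A\<close> and \<open>0\<close> otherwise. All distances are at most \<open>1\<close>, while
  for disjoint sets \<open>S\<^sub>1\<close> and \<open>S\<^sub>2\<close> of points the coordinate at \<open>A = S\<^sub>1\<close> is constantly \<open>1\<close> on
  \<open>conv S\<^sub>1\<close> and constantly \<open>0\<close> on \<open>conv S\<^sub>2\<close>. Hence every \<open>x\<close> is at distance at least \<open>1/2\<close> from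
  one of the two hulls.
\<close>

text \<open>The hyperplane \<open>coord y n = c\<close> is convex, so it contains the whole hull,
  and the max norm dominates the difference in coordinate \<open>n\<close>.\<close>

lemma abs_coord_diff_le_infdist_convex_hull:
  fixes x :: "'n::finite linf"
  assumes "S \<noteq> {}" and c: "\<And>y. y \<in> S \<Longrightarrow> coord y n = c"
  shows "\<bar>coord x n - c\<bar> \<le> infdist x (convex hull S)"
proof -
  have "convex {y :: 'n linf. coord y n = c}"
    by (auto simp: convex_def simp flip: distrib_right)
  with c have hull: "convex hull S \<subseteq> {y. coord y n = c}"
    by (intro hull_minimal) auto
  have "\<bar>coord x n - c\<bar> \<le> dist x y" if "y \<in> convex hull S" for y
    using that hull abs_coord_le_linf_norm[of "x - y" n] by (auto simp: dist_norm)
  with \<open>S \<noteq> {}\<close> show ?thesis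
    by (auto simp: infdist_def intro!: cINF_greatest)
qed

text \<open>The gaps from \<open>coord x n\<close> to 1 and to 0 add up to at least 1, so one of
  them is at least 1/2.\<close>

lemma half_le_max_infdist_convex_hull:
  fixes x :: "'n::finite linf"
  assumes "S \<noteq> {}" "T \<noteq> {}"
    and "\<And>y. y \<in> S \<Longrightarrow> coord y n = 1" "\<And>y. y \<in> T \<Longrightarrow> coord y n = 0"
  shows "1 / 2 \<le> max (infdist x (convex hull S)) (infdist x (convex hull T))"
  using abs_coord_diff_le_infdist_convex_hull[of S n 1 x]
    abs_coord_diff_le_infdist_convex_hull[of T n 0 x] assms by fastforce

text \<open>The map \<open>g\<close> labels coordinates by sets, so that any index type of the right
  cardinality can stand for a power set.\<close>

definition cube_point :: "('n \<Rightarrow> 'q set) \<Rightarrow> 'q \<Rightarrow> 'n linf" where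
  "cube_point g q = Abs_linf (\<lambda>n. if q \<in> g n then 1 else 0)"

lemma coord_cube_point [simp]: "coord (cube_point g q) n = (if q \<in> g n then 1 else 0)"
  by (simp add: cube_point_def)

lemma dist_cube_point_le: "dist (cube_point g p) (cube_point g q :: 'n::finite linf) \<le> 1"
  unfolding dist_norm by (rule linf_norm_leI) simp

text \<open>The coordinate labelled \<open>{p}\<close> separates \<open>p\<close> from every other
  element.\<close>

lemma inj_on_cube_point:
  assumes "Pow Q \<subseteq> range g"
  shows "inj_on (cube_point g) Q"
proof (rule inj_onI)
  fix p q assume "p \<in> Q" "q \<in> Q" and eq: "cube_point g p = cube_point g q"
  then obtain n where "g n = {p}"
    using assms by (metis PowI empty_subsetI image_iff insert_subset subsetD)
  with arg_cong[OF eq, of "\<lambda>y. coord y n"] show "p = q" by (auto split: if_splits)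
qed

lemma diameter_cube_point_le:
  fixes g :: "'n::finite \<Rightarrow> 'q set"
  shows "diameter (cube_point g ` A) \<le> 1"
  by (rule diameter_le) (auto simp: dist_cube_point_le simp flip: dist_norm)

lemma diameter_pos:
  fixes A :: "'a::metric_space set"
  assumes "finite A" "card A \<ge> 2"
  shows "diameter A > 0"
proof -
  from assms(2) obtain a b where "a \<in> A" "b \<in> A" "a \<noteq> b"
    by (metis card_le_Suc0_iff_eq assms(1) not_less_eq_eq numeral_2_eq_2)
  then show ?thesis
    using diameter_bounded_bound[OF finite_imp_bounded[OF assms(1)], of a b]
    by (smt (verit) zero_less_dist_iff)
qed

theorem lemma10p4:
  fixes r k :: nat
  assumes "r \<ge> 1" and "k \<ge> 2" and "CARD('n::finite) = 2 ^ (r * k)"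
  shows "Tv TYPE('n linf) r k \<ge> 1 / 2"
proof -
  \<comment> \<open>A pair \<open>(j, i)\<close> names the \<open>i\<close>-th point of colour
    \<open>j\<close>; these \<open>r * k\<close> names have exactly as many subsets as there are
    coordinates.\<close>
  define Q where "Q = {1..r} \<times> {1..k}"
  have "card (Pow Q) = CARD('n)" and "finite (Pow Q)"
    using assms(3) by (auto simp: Q_def card_Pow)
  then obtain g :: "'n \<Rightarrow> (nat \<times> nat) set" where "bij_betw g UNIV (Pow Q)"
    by (metis finite_same_card_bij finite_class.finite_UNIV)
  then have g: "range g = Pow Q" by (simp add: bij_betw_def)
  define Z where "Z j = cube_point g ` ({j} \<times> {1..k})" for j
  have inj: "inj_on (cube_point g) Q" using g by (intro inj_on_cube_point) simp
  have fin: "finite (Z j)" for j by (simp add: Z_def)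
  have card: "card (Z j) = k" if "j \<in> {1..r}" for j
  proof -
    have "inj_on (cube_point g) ({j} \<times> {1..k})"
      by (rule inj_on_subset[OF inj]) (use that in \<open>auto simp: Q_def\<close>)
    then show ?thesis by (simp add: Z_def card_image)
  qed
  have disj: "disjoint_family_on Z {1..r}"
  proof (unfold disjoint_family_on_def, intro ballI impI)
    fix i j assume "i \<in> {1..r}" "j \<in> {1..r}" "i \<noteq> j"
    then show "Z i \<inter> Z j = {}"
      unfolding Z_def
      by (subst inj_on_image_Int[OF inj, symmetric]) (auto simp: Q_def)
  qed
  have Z: "color_classes r k Z"
    using fin card disj by (simp add: color_classes_def)
  define D where "D = (MAX j\<in>{1..r}. diameter (Z j))"
  \<comment> \<open>The maximum is attained, so bounds on single diameters pass to
    \<open>D\<close>.\<close>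
  have "D \<in> (\<lambda>j. diameter (Z j)) ` {1..r}"
    unfolding D_def using assms(1) by (intro Max_in) auto
  then have D: "0 < D" "D \<le> 1"
    using diameter_pos[OF fin] card assms(2) diameter_cube_point_le[of g] by (auto simp: Z_def)
  have half: "1 / 2 \<le> (MAX i\<in>{1..k}. infdist x (convex hull S i)) / D"
    if S: "colorful_partition r k Z S" for x and S :: "nat \<Rightarrow> 'n linf set"
  proof -
    let ?f = "\<lambda>i. infdist x (convex hull S i)"
    \<comment> \<open>\<open>infdist\<close> to an empty set is 0 by convention, so this case must
      be excluded; colour 1 exists since \<open>r \<ge> 1\<close>.\<close>
    have ne: "S i \<noteq> {}" if "i \<in> {1..k}" for i
    proof
      assume "S i = {}"
      moreover have "card (S i \<inter> Z 1) = 1"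
        using S that assms(1) by (auto simp: colorful_partition_def)
      ultimately show False by simp
    qed
    have S12: "S 1 \<inter> S 2 = {}"
      using S assms(2) by (auto simp: colorful_partition_def disjoint_family_on_def)
    have sub: "S i \<subseteq> cube_point g ` Q" if "i \<in> {1..k}" for i
    proof -
      have "S i \<subseteq> (\<Union>j\<in>{1..r}. Z j)"
        using S that by (auto simp: colorful_partition_def)
      also have "\<dots> \<subseteq> cube_point g ` Q" by (auto simp: Z_def Q_def)
      finally show ?thesis .
    qed
    \<comment> \<open>The separating coordinate depends on the partition: its label is the set of
      names of the points in \<open>S 1\<close>.\<close>
    have "{q \<in> Q. cube_point g q \<in> S 1} \<in> range g" by (auto simp: g)
    then obtain n where n: "g n = {q \<in> Q. cube_point g q \<in> S 1}" by auto
    have "1 / 2 \<le> max (?f 1) (?f 2)"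
    proof (rule half_le_max_infdist_convex_hull)
      show "S 1 \<noteq> {}" "S 2 \<noteq> {}" using ne assms(2) by auto
      show "coord y n = 1" if "y \<in> S 1" for y
        using that sub[of 1] assms(2) by (auto simp: n)
      show "coord y n = 0" if y: "y \<in> S 2" for y
      proof -
        obtain q where "y = cube_point g q" using y sub[of 2] assms(2) by auto
        moreover have "y \<notin> S 1" using y S12 by blast
        ultimately show ?thesis by (simp add: n)
      qed
    qed
    also have "\<dots> \<le> (MAX i\<in>{1..k}. ?f i)"
      using assms(2) by (intro max.boundedI Max_ge) auto
    finally have "1 / 2 \<le> (MAX i\<in>{1..k}. ?f i)" .
    \<comment> \<open>Dividing by \<open>D\<close> with \<open>0 < D \<le> 1\<close> cannot decrease
      a nonnegative value.\<close>
    with D show ?thesis by (simp add: field_simps)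
  qed
  have "ereal (1 / 2) \<le> (INF (x, S) \<in> UNIV \<times> {S. colorful_partition r k Z S}.
      ereal ((MAX i\<in>{1..k}. infdist x (convex hull S i)) / D))"
    using half by (intro INF_greatest) auto
  also have "\<dots> \<le> Tv TYPE('n linf) r k"
    unfolding Tv_def D_def by (rule SUP_upper) (simp add: Z)
  finally show ?thesis by (simp add: one_ereal_def)
qed

end
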